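(* Let $X$ be a metric space. If $X$ admits a coarse embedding into $\ell_2$, then $X$ admits a coarse embedding into $\ell_p$ for every $1\le p<\infty$. In particular, the separable Hilbert space $\ell_2$ admits a coarse embedding into $\ell_p$ for every $1\le p<\infty$.
   Context: For $1\le p<\infty$, $\ell_p=\ell_p(\mathbb{N})$ is the Banach space of real $p$-summable sequences with norm $\|x\|_p=\left(\sum_i |x_i|^p\right)^{1/p}$, regarded as a metric space with the norm metric. Let $X,Y$ be metric spaces. A map $f\colon X\to Y$ (not necessarily continuous) is a coarse embedding if there exist non-decreasing functions $\rho_1,\rho_2\colon[0,\infty)\to[0,\infty)$ such that (1) $\rho_1(d_X(x,y))\le d_Y(f(x),f(y))\le\rho_2(d_X(x,y))$ for all $x,y\in X$, and (2) $\lim_{t\to\infty}\rho_1(t)=+\infty$. The space $X$ admits a coarse embedding into $Y$ if such a map $f$ exists. *)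

theory Defs
  imports "HOL-Analysis.Analysis"
begin

definition lp_space :: "real \<Rightarrow> (nat \<Rightarrow> real) set"
  where "lp_space p = {x. summable (\<lambda>i. \<bar>x i\<bar> powr p)}"

definition lp_norm :: "real \<Rightarrow> (nat \<Rightarrow> real) \<Rightarrow> real"
  where "lp_norm p x = (\<Sum>i. \<bar>x i\<bar> powr p) powr (1 / p)"

text \<open>Meaningful only for \<open>p \<ge> 1\<close>: for other \<open>p\<close> the pair need not be a metric space, and
  \<^const>\<open>metric\<close> is then unspecified. That it is a metric space for \<open>p \<ge> 1\<close> is shown below.\<close>

definition lp_metric :: "real \<Rightarrow> (nat \<Rightarrow> real) metric"
  where "lp_metric p = metric (lp_space p, \<lambda>x y. lp_norm p (\<lambda>i. x i - y i))"

text \<open>The control functions are of type \<^typ>\<open>real \<Rightarrow> real\<close>, but only their restrictions to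
  \<open>[0,\<infinity>)\<close> are constrained.\<close>

definition coarse_embedding :: "'a metric \<Rightarrow> 'b metric \<Rightarrow> ('a \<Rightarrow> 'b) \<Rightarrow> bool"
  where "coarse_embedding X Y f \<longleftrightarrow>
    f \<in> mspace X \<rightarrow> mspace Y \<and>
    (\<exists>\<rho>\<^sub>1 \<rho>\<^sub>2 :: real \<Rightarrow> real.
      \<rho>\<^sub>1 \<in> {0..} \<rightarrow> {0..} \<and> mono_on {0..} \<rho>\<^sub>1 \<and>
      \<rho>\<^sub>2 \<in> {0..} \<rightarrow> {0..} \<and> mono_on {0..} \<rho>\<^sub>2 \<and>
      (\<forall>x \<in> mspace X. \<forall>y \<in> mspace X.
         \<rho>\<^sub>1 (mdist X x y) \<le> mdist Y (f x) (f y) \<and> mdist Y (f x) (f y) \<le> \<rho>\<^sub>2 (mdist X x y)) \<and>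
      filterlim \<rho>\<^sub>1 at_top at_top)"

definition coarsely_embeds :: "'a metric \<Rightarrow> 'b metric \<Rightarrow> bool"
  where "coarsely_embeds X Y \<longleftrightarrow> (\<exists>f. coarse_embedding X Y f)"

lemma powr_weighted_add_le:
  fixes a b A B p :: real
  assumes "a \<ge> 0" "b \<ge> 0" "A > 0" "B > 0" "p \<ge> 1"
  shows "(a + b) powr p \<le>
    (A + B) powr p * (A / (A + B) * (a / A) powr p + B / (A + B) * (b / B) powr p)"
proof -
  define t where "t = A / (A + B)"
  define u where "u = B / (A + B)"
  have tu: "t > 0" "u > 0" "t + u = 1"
    using assms by (auto simp: t_def u_def add_divide_distrib [symmetric])
  have small: "s powr p \<le> s" if "0 < s" "s \<le> 1" for s :: real
    using powr_mono' [of 1 p s] that assms by simp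
  have conv: "(t * v + u * w) powr p \<le> t * v powr p + u * w powr p"
    if vw: "v \<ge> 0" "w \<ge> 0" for v w
  proof -
    consider "v = 0" | "w = 0" | "v > 0" "w > 0" using vw by fastforce
    then show ?thesis
    proof cases
      case 1
      have "(u * w) powr p = u powr p * w powr p" using tu vw by (simp add: powr_mult)
      also have "\<dots> \<le> u * w powr p" using tu by (intro mult_right_mono small) auto
      finally show ?thesis using 1 tu by simp
    next
      case 2
      have "(t * v) powr p = t powr p * v powr p" using tu vw by (simp add: powr_mult)
      also have "\<dots> \<le> t * v powr p" using tu by (intro mult_right_mono small) auto
      finally show ?thesis using 2 tu by simp
    next
      case 3
      have u: "u = 1 - t" using tu by simp
      show ?thesis
        using convex_onD [OF powr_convex [OF assms(5)], of u v w] tu 3 u by simp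
    qed
  qed
  have "t * (a / A) + u * (b / B) = (a + b) / (A + B)"
    using assms by (simp add: t_def u_def add_divide_distrib)
  then have "a + b = (A + B) * (t * (a / A) + u * (b / B))"
    using assms by simp
  then have "(a + b) powr p = (A + B) powr p * (t * (a / A) + u * (b / B)) powr p"
    using assms tu by (simp add: powr_mult)
  also have "\<dots> \<le> (A + B) powr p * (t * (a / A) powr p + u * (b / B) powr p)"
    using assms by (intro mult_left_mono conv) auto
  finally show ?thesis by (simp add: t_def u_def)
qed

lemma lp_space_add:
  assumes "p \<ge> 1" "x \<in> lp_space p" "y \<in> lp_space p"
  shows "(\<lambda>i. x i + y i) \<in> lp_space p"
proof -
  have le: "\<bar>x i + y i\<bar> powr p \<le>
      2 powr p * (1 / 2 * \<bar>x i\<bar> powr p + 1 / 2 * \<bar>y i\<bar> powr p)" for i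
  proof -
    have "\<bar>x i + y i\<bar> powr p \<le> (\<bar>x i\<bar> + \<bar>y i\<bar>) powr p"
      using assms by (intro powr_mono2) auto
    then show ?thesis
      using powr_weighted_add_le [of "\<bar>x i\<bar>" "\<bar>y i\<bar>" 1 1 p] assms by simp
  qed
  have "summable (\<lambda>i. 2 powr p * (1 / 2 * \<bar>x i\<bar> powr p + 1 / 2 * \<bar>y i\<bar> powr p))"
    using assms unfolding lp_space_def by (intro summable_mult summable_add) auto
  then have "summable (\<lambda>i. \<bar>x i + y i\<bar> powr p)"
    by (rule summable_comparison_test' [where N = 0])
      (simp only: real_norm_def abs_of_nonneg [OF powr_ge_zero] le)
  then show ?thesis by (simp add: lp_space_def)
qed

lemma lp_space_diff:
  assumes "p \<ge> 1" "x \<in> lp_space p" "y \<in> lp_space p"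
  shows "(\<lambda>i. x i - y i) \<in> lp_space p"
  using lp_space_add [of p x "\<lambda>i. - y i"] assms by (simp add: lp_space_def)

lemma lp_norm_nonneg [simp]: "lp_norm p x \<ge> 0"
  by (simp add: lp_norm_def)

lemma lp_norm_eq_0_iff:
  assumes "p \<ge> 1" "x \<in> lp_space p"
  shows "lp_norm p x = 0 \<longleftrightarrow> (\<forall>i. x i = 0)"
  using assms suminf_eq_zero_iff [of "\<lambda>i. \<bar>x i\<bar> powr p"]
  by (auto simp: lp_norm_def lp_space_def)

lemma lp_norm_powr:
  assumes "p \<ge> 1" "x \<in> lp_space p"
  shows "lp_norm p x powr p = (\<Sum>i. \<bar>x i\<bar> powr p)"
  using assms suminf_nonneg [of "\<lambda>i. \<bar>x i\<bar> powr p"]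
  by (simp add: lp_norm_def lp_space_def powr_powr)

lemma lp_norm_triangle:
  assumes p: "p \<ge> 1" and x: "x \<in> lp_space p" and y: "y \<in> lp_space p"
  shows "lp_norm p (\<lambda>i. x i + y i) \<le> lp_norm p x + lp_norm p y"
proof -
  define A where "A = lp_norm p x"
  define B where "B = lp_norm p y"
  have AB0: "A \<ge> 0" "B \<ge> 0" by (auto simp: A_def B_def)
  consider "A = 0" | "B = 0" | "A > 0" "B > 0" using AB0 by fastforce
  then show ?thesis
  proof cases
    case 1
    then have "\<forall>i. x i = 0" using lp_norm_eq_0_iff [OF p x] by (simp add: A_def)
    then show ?thesis by simp
  next
    case 2
    then have "\<forall>i. y i = 0" using lp_norm_eq_0_iff [OF p y] by (simp add: B_def)
    then show ?thesis by simp
  next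
    case 3
    let ?g = "\<lambda>i. (A + B) powr p *
      (A / (A + B) * (\<bar>x i\<bar> powr p / A powr p) + B / (A + B) * (\<bar>y i\<bar> powr p / B powr p))"
    have sx: "(\<lambda>i. \<bar>x i\<bar> powr p) sums (A powr p)"
      using lp_norm_powr [OF p x] x by (simp add: A_def lp_space_def summable_sums)
    have sy: "(\<lambda>i. \<bar>y i\<bar> powr p) sums (B powr p)"
      using lp_norm_powr [OF p y] y by (simp add: B_def lp_space_def summable_sums)
    have "?g sums ((A + B) powr p *
      (A / (A + B) * (A powr p / A powr p) + B / (A + B) * (B powr p / B powr p)))"
      by (intro sums_mult sums_add sums_divide sx sy)
    moreover have "A / (A + B) * (A powr p / A powr p) + B / (A + B) * (B powr p / B powr p) = 1"
      using 3 by (simp add: add_divide_distrib [symmetric])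
    ultimately have g: "?g sums ((A + B) powr p)" by simp
    have le: "\<bar>x i + y i\<bar> powr p \<le> ?g i" for i
    proof -
      have "\<bar>x i + y i\<bar> powr p \<le> (\<bar>x i\<bar> + \<bar>y i\<bar>) powr p"
        using p by (intro powr_mono2) auto
      also have "\<dots> \<le> ?g i"
        using powr_weighted_add_le [of "\<bar>x i\<bar>" "\<bar>y i\<bar>" A B p] 3 p by (simp add: powr_divide)
      finally show ?thesis .
    qed
    have s: "summable (\<lambda>i. \<bar>x i + y i\<bar> powr p)"
      using lp_space_add [OF p x y] by (simp add: lp_space_def)
    have "(\<Sum>i. \<bar>x i + y i\<bar> powr p) \<le> (A + B) powr p"
      using suminf_le [OF le s sums_summable [OF g]] sums_unique [OF g] by simp
    then have "lp_norm p (\<lambda>i. x i + y i) \<le> ((A + B) powr p) powr (1 / p)"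
      unfolding lp_norm_def using p s by (intro powr_mono2 suminf_nonneg) auto
    also have "\<dots> = A + B" using p 3 by (simp add: powr_powr)
    finally show ?thesis by (simp add: A_def B_def)
  qed
qed

lemma Metric_space_lp:
  assumes p: "p \<ge> 1"
  shows "Metric_space (lp_space p) (\<lambda>x y. lp_norm p (\<lambda>i. x i - y i))"
proof
  fix x y z
  show "0 \<le> lp_norm p (\<lambda>i. x i - y i)" by simp
  show "lp_norm p (\<lambda>i. x i - y i) = lp_norm p (\<lambda>i. y i - x i)"
    by (simp add: lp_norm_def abs_minus_commute)
  assume xy: "x \<in> lp_space p" "y \<in> lp_space p"
  show "(lp_norm p (\<lambda>i. x i - y i) = 0) = (x = y)"
    using lp_norm_eq_0_iff [OF p lp_space_diff [OF p xy]] by (auto simp: fun_eq_iff)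
  assume z: "z \<in> lp_space p"
  show "lp_norm p (\<lambda>i. x i - z i) \<le> lp_norm p (\<lambda>i. x i - y i) + lp_norm p (\<lambda>i. y i - z i)"
    using lp_norm_triangle [OF p lp_space_diff [OF p xy] lp_space_diff [OF p xy(2) z]] by simp
qed

lemma mspace_lp_metric: "p \<ge> 1 \<Longrightarrow> mspace (lp_metric p) = lp_space p"
  by (simp add: lp_metric_def Metric_space.mspace_metric [OF Metric_space_lp])

lemma mdist_lp_metric:
  "p \<ge> 1 \<Longrightarrow> mdist (lp_metric p) = (\<lambda>x y. lp_norm p (\<lambda>i. x i - y i))"
  by (simp add: lp_metric_def Metric_space.mdist_metric [OF Metric_space_lp])

end

theory Submission
  imports Defs
begin

text \<open>
  Coarse embeddings compose, so everything rests on embedding \<open>\<ell>\<^sub>2\<close> coarsely into \<open>\<ell>\<^sub>p\<close>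
  (\<open>l2_coarsely_embeds_lp\<close>). The embedding is a direct sum of maps into the unit sphere of
  \<open>\<ell>\<^sub>p\<close>, each of which sees \<open>\<ell>\<^sub>2\<close> at one scale.

  The Gaussian kernel \<open>exp (- \<parallel>u - v\<parallel>\<^sup>2 / 2)\<close> is positive definite on \<open>\<ell>\<^sub>2\<close>. Expanding the
  exponential series of the inner product as a sum over all finite words of coordinates gives
  an explicit map of \<open>\<ell>\<^sub>2\<close> into the unit sphere of the space of square summable families indexed
  by words, whose inner products are the values of that kernel (\<open>gauss_feature_kernel\<close>).
  Hence the distance of two images depends on \<open>\<parallel>u - v\<parallel>\<close> alone: it tends to \<open>0\<close> with
  \<open>\<parallel>u - v\<parallel>\<close> and stays away from \<open>0\<close> when \<open>\<parallel>u - v\<parallel>\<close> is large.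

  The Mazur map, which raises every coordinate to the power \<open>2 / p\<close> and keeps its sign, carries
  the unit sphere of \<open>\<ell>\<^sub>2\<close> to that of \<open>\<ell>\<^sub>p\<close> and is uniformly continuous in both directions.
  Both moduli of continuity come from one inequality between real numbers
  (\<open>signed_powr_modulus\<close>), summed over the coordinates. So the two properties above survive in
  \<open>\<ell>\<^sub>p\<close> (\<open>sphere_dist_le\<close>, \<open>sphere_dist_ge\<close>).

  Precomposing with a small dilation makes the map as flat as desired on pairs at distance at
  most \<open>n\<close>, and the separation \<open>c\<close> of far pairs is the same for all dilations. Choosing for
  each \<open>n\<close> a dilation for which such pairs contribute at most \<open>1 / 2 ^ n\<close> makes the direct sum
  converge; it is expanding because more and more summands contribute at least \<open>c\<close> as the
  distance grows (\<open>coarsely_embeds_lp_glue\<close>).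
\<close>

section \<open>Coarse embeddings\<close>

text \<open>
  It suffices that bounded distances go to bounded distances and that large distances go to
  large ones: the optimal control functions are the infimum of the image distances over pairs
  at distance at least \<open>t\<close>, and the supremum over those at distance at most \<open>t\<close>.
\<close>

lemma coarse_embeddingI:
  assumes f: "f \<in> mspace X \<rightarrow> mspace Y"
    and bounded: "\<And>r. \<exists>S. \<forall>x\<in>mspace X. \<forall>y\<in>mspace X.
      mdist X x y \<le> r \<longrightarrow> mdist Y (f x) (f y) \<le> S"
    and proper: "\<And>S. \<exists>r. \<forall>x\<in>mspace X. \<forall>y\<in>mspace X.
      r \<le> mdist X x y \<longrightarrow> S \<le> mdist Y (f x) (f y)"
  shows "coarse_embedding X Y f"
proof -
  \<comment> \<open>Adding the point \<open>t\<close> keeps the infimum meaningful, and tending to infinity, when no two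
    points have distance at least \<open>t\<close>; adding \<open>0\<close> below keeps the supremum meaningful.\<close>
  define L where "L t = insert t
    {mdist Y (f x) (f y) | x y. x \<in> mspace X \<and> y \<in> mspace X \<and> t \<le> mdist X x y}" for t
  define U where "U t = insert 0
    {mdist Y (f x) (f y) | x y. x \<in> mspace X \<and> y \<in> mspace X \<and> mdist X x y \<le> t}" for t
  have L_nonneg: "0 \<le> e" if "e \<in> L t" "0 \<le> t" for e t
    using that by (auto simp: L_def)
  have L_bdd: "bdd_below (L t)" if "0 \<le> t" for t
    using L_nonneg that by (meson bdd_belowI)
  have L_ne: "L t \<noteq> {}" for t
    by (simp add: L_def)
  have U_bdd: "bdd_above (U t)" for t
  proof -
    obtain S where S: "\<forall>x\<in>mspace X. \<forall>y\<in>mspace X.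
      mdist X x y \<le> t \<longrightarrow> mdist Y (f x) (f y) \<le> S"
      using bounded by blast
    then have "\<forall>e\<in>U t. e \<le> max 0 S"
      by (fastforce simp: U_def)
    then show ?thesis
      by (meson bdd_aboveI)
  qed
  have "(\<lambda>t. Inf (L t)) \<in> {0..} \<rightarrow> {0..}"
    using L_nonneg L_ne by (auto intro!: cInf_greatest)
  moreover have "mono_on {0..} (\<lambda>t. Inf (L t))"
  proof (rule mono_onI)
    fix s t :: real
    assume st: "s \<in> {0..}" "t \<in> {0..}" "s \<le> t"
    show "Inf (L s) \<le> Inf (L t)"
    proof (rule cInf_greatest [OF L_ne])
      fix e assume "e \<in> L t"
      then have "e = t \<or> e \<in> L s"
        using st unfolding L_def by (fastforce intro: order_trans)
      moreover have "Inf (L s) \<le> t"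
        using cInf_lower [OF _ L_bdd, of s s] st by (auto simp: L_def)
      ultimately show "Inf (L s) \<le> e"
        using cInf_lower [OF _ L_bdd, of e s] st by auto
    qed
  qed
  moreover have "(\<lambda>t. Sup (U t)) \<in> {0..} \<rightarrow> {0..}"
    using U_bdd by (auto intro!: cSup_upper simp: U_def)
  moreover have "mono_on {0..} (\<lambda>t. Sup (U t))"
  proof (rule mono_onI)
    fix s t :: real
    assume "s \<le> t"
    then have "U s \<subseteq> U t"
      unfolding U_def by (fastforce intro: order_trans)
    then show "Sup (U s) \<le> Sup (U t)"
      by (intro cSup_subset_mono U_bdd) (auto simp: U_def)
  qed
  moreover have "Inf (L (mdist X x y)) \<le> mdist Y (f x) (f y) \<and>
      mdist Y (f x) (f y) \<le> Sup (U (mdist X x y))"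
    if "x \<in> mspace X" "y \<in> mspace X" for x y
  proof
    show "Inf (L (mdist X x y)) \<le> mdist Y (f x) (f y)"
      using that by (intro cInf_lower L_bdd) (auto simp: L_def)
    show "mdist Y (f x) (f y) \<le> Sup (U (mdist X x y))"
      using that by (intro cSup_upper U_bdd) (auto simp: U_def)
  qed
  moreover have "filterlim (\<lambda>t. Inf (L t)) at_top at_top"
    unfolding filterlim_at_top
  proof
    fix S
    obtain r where r: "\<forall>x\<in>mspace X. \<forall>y\<in>mspace X.
      r \<le> mdist X x y \<longrightarrow> S \<le> mdist Y (f x) (f y)"
      using proper by blast
    have "S \<le> Inf (L t)" if "max r S \<le> t" for t
      using r that by (intro cInf_greatest L_ne) (fastforce simp: L_def)
    then show "\<forall>\<^sub>F t in at_top. S \<le> Inf (L t)"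
      unfolding eventually_at_top_linorder by blast
  qed
  ultimately show ?thesis
    unfolding coarse_embedding_def using f by blast
qed

lemma coarse_embedding_compose:
  assumes f: "coarse_embedding X Y f" and g: "coarse_embedding Y Z g"
  shows "coarse_embedding X Z (g \<circ> f)"
proof -
  obtain r1 r2 where r: "f \<in> mspace X \<rightarrow> mspace Y"
      "r1 \<in> {0..} \<rightarrow> {0..}" "mono_on {0..} r1"
      "r2 \<in> {0..} \<rightarrow> {0..}" "mono_on {0..} r2"
      "\<forall>x \<in> mspace X. \<forall>y \<in> mspace X.
         r1 (mdist X x y) \<le> mdist Y (f x) (f y) \<and> mdist Y (f x) (f y) \<le> r2 (mdist X x y)"
      "filterlim r1 at_top (at_top :: real filter)"
    using f unfolding coarse_embedding_def by blast
  obtain s1 s2 where s: "g \<in> mspace Y \<rightarrow> mspace Z"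
      "s1 \<in> {0..} \<rightarrow> {0..}" "mono_on {0..} s1"
      "s2 \<in> {0..} \<rightarrow> {0..}" "mono_on {0..} s2"
      "\<forall>x \<in> mspace Y. \<forall>y \<in> mspace Y.
         s1 (mdist Y x y) \<le> mdist Z (g x) (g y) \<and> mdist Z (g x) (g y) \<le> s2 (mdist Y x y)"
      "filterlim s1 at_top (at_top :: real filter)"
    using g unfolding coarse_embedding_def by blast
  have nonneg: "0 \<le> r1 t" "0 \<le> r2 t" if "0 \<le> t" for t
    using r that by auto
  have "g \<circ> f \<in> mspace X \<rightarrow> mspace Z"
    using r(1) s(1) by auto
  moreover have "s1 \<circ> r1 \<in> {0..} \<rightarrow> {0..}" "s2 \<circ> r2 \<in> {0..} \<rightarrow> {0..}"
    using r s by auto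
  moreover have "mono_on {0..} (s1 \<circ> r1)" "mono_on {0..} (s2 \<circ> r2)"
    using r s nonneg by (auto simp: mono_on_def)
  moreover have "(s1 \<circ> r1) (mdist X x y) \<le> mdist Z ((g \<circ> f) x) ((g \<circ> f) y) \<and>
      mdist Z ((g \<circ> f) x) ((g \<circ> f) y) \<le> (s2 \<circ> r2) (mdist X x y)"
    if xy: "x \<in> mspace X" "y \<in> mspace X" for x y
  proof -
    have Y: "f x \<in> mspace Y" "f y \<in> mspace Y"
      using r(1) xy by auto
    have "s1 (r1 (mdist X x y)) \<le> s1 (mdist Y (f x) (f y))"
      using r(6) xy nonneg by (intro mono_onD [OF s(3)]) auto
    moreover have "s2 (mdist Y (f x) (f y)) \<le> s2 (r2 (mdist X x y))"
      using r(6) xy nonneg by (intro mono_onD [OF s(5)]) auto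
    ultimately show ?thesis
      using s(6) Y by force
  qed
  moreover have "filterlim (s1 \<circ> r1) at_top at_top"
    unfolding comp_def by (rule filterlim_compose [OF s(7) r(7)])
  ultimately show ?thesis
    unfolding coarse_embedding_def by blast
qed

section \<open>Gluing maps at different scales\<close>

text \<open>
  The embedding is \<open>x \<mapsto> (\<Phi>\<^sub>n x - \<Phi>\<^sub>n x\<^sub>0)\<^sub>n\<close>; subtracting the base point makes the family
  \<open>p\<close>-summable and does not affect differences. The \<open>p\<close>-th power of the distance of two images
  is the sum of all \<open>D n x y\<close>. If \<open>x\<close> and \<open>y\<close> are at distance at most \<open>N\<close>, the first \<open>N\<close> terms are
  at most \<open>K\<close> and the others are dominated by a geometric series. If \<open>x\<close> and \<open>y\<close> are far apart,
  many terms are at least \<open>c\<close>.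
\<close>

lemma coarsely_embeds_lp_glue:
  fixes X :: "'a metric" and \<Phi> :: "nat \<Rightarrow> 'a \<Rightarrow> 'b::countable \<Rightarrow> real" and p :: real
  defines "D \<equiv> \<lambda>n x y. \<Sum>\<^sub>\<infinity>w. \<bar>\<Phi> n x w - \<Phi> n y w\<bar> powr p"
  assumes p: "p \<ge> 1"
    and summable: "\<And>n x y. x \<in> mspace X \<Longrightarrow> y \<in> mspace X \<Longrightarrow>
      (\<lambda>w. \<bar>\<Phi> n x w - \<Phi> n y w\<bar> powr p) summable_on UNIV"
    and bounded: "\<And>n x y. x \<in> mspace X \<Longrightarrow> y \<in> mspace X \<Longrightarrow> D n x y \<le> K"
    and close: "\<And>n x y. x \<in> mspace X \<Longrightarrow> y \<in> mspace X \<Longrightarrow> mdist X x y \<le> real n \<Longrightarrow>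
      D n x y \<le> (1 / 2) ^ n"
    and c: "c > 0"
    and far: "\<And>n. \<exists>r. \<forall>x\<in>mspace X. \<forall>y\<in>mspace X. r \<le> mdist X x y \<longrightarrow> c \<le> D n x y"
  shows "coarsely_embeds X (lp_metric p)"
proof -
  \<comment> \<open>If the space is empty, the value of the base point is irrelevant.\<close>
  define x0 where "x0 = (SOME x. x \<in> mspace X)"
  have x0: "x0 \<in> mspace X" if "x \<in> mspace X" for x
    unfolding x0_def using that by (rule someI)
  define f where "f x i = (case from_nat_into UNIV i of (n, w) \<Rightarrow> \<Phi> n x w - \<Phi> n x0 w)" for x i
  have bij: "bij_betw (from_nat_into UNIV) UNIV (UNIV :: (nat \<times> 'b) set)"
    by (intro bij_betw_from_nat_into) (auto simp: finite_prod)
  define E where "E x y = (\<Sum>\<^sub>\<infinity>n. D n x y)" for x y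
  have D_nonneg: "0 \<le> D n x y" for n x y
    unfolding D_def by (rule infsum_nonneg) simp
  define M where "M N n = (if n < N then K else 0) + (1 / 2) ^ n" for N n :: nat
  have M_sum: "(M N has_sum (real N * K + 2)) UNIV" for N
  proof -
    have "((\<lambda>n. (1 / 2 :: real) ^ n) has_sum 2) UNIV"
      using geometric_sums [of "1 / 2 :: real"] by (intro sums_nonneg_imp_has_sum) auto
    moreover have "((\<lambda>n. if n < N then K else 0) has_sum (real N * K)) UNIV"
      using has_sum_finiteI [of "{..<N}" "real N * K" "\<lambda>n. K"]
      by (subst has_sum_cong_neutral [where T = "{..<N}" and g = "\<lambda>n. K"]) auto
    ultimately show ?thesis
      unfolding M_def by (intro has_sum_add)
  qed
  have D_le: "D n x y \<le> M N n"
    if "x \<in> mspace X" "y \<in> mspace X" "mdist X x y \<le> real N" for x y n N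
  proof (cases "n < N")
    case True
    have "D n x y \<le> K" "0 \<le> (1 / 2 :: real) ^ n"
      using bounded that by auto
    moreover have "M N n = K + (1 / 2) ^ n"
      using True by (simp add: M_def)
    ultimately show ?thesis
      by linarith
  next
    case False
    then show ?thesis
      using close [of x y n] that by (simp add: M_def)
  qed
  have D_summable: "(\<lambda>n. D n x y) summable_on UNIV" if "x \<in> mspace X" "y \<in> mspace X" for x y
  proof -
    obtain N where N: "mdist X x y \<le> real N"
      using real_arch_simple by blast
    show ?thesis
      using D_le [OF that N] D_nonneg
      by (intro summable_on_comparison_test [OF has_sum_imp_summable [OF M_sum]])
  qed
  have pair_sum: "((\<lambda>(n, w). \<bar>\<Phi> n x w - \<Phi> n y w\<bar> powr p) has_sum E x y) UNIV"
    if xy: "x \<in> mspace X" "y \<in> mspace X" for x y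
  proof -
    have inner: "((\<lambda>w. \<bar>\<Phi> n x w - \<Phi> n y w\<bar> powr p) has_sum D n x y) UNIV" for n
      unfolding D_def using summable [OF xy] by (rule has_sum_infsum)
    have outer: "((\<lambda>n. D n x y) has_sum E x y) UNIV"
      unfolding E_def using D_summable [OF xy] by (rule has_sum_infsum)
    have "(\<lambda>(n, w). \<bar>\<Phi> n x w - \<Phi> n y w\<bar> powr p) summable_on Sigma UNIV (\<lambda>_. UNIV)"
      using inner D_summable [OF xy] by (intro summable_on_SigmaI) auto
    then have "((\<lambda>(n, w). \<bar>\<Phi> n x w - \<Phi> n y w\<bar> powr p) has_sum E x y) (Sigma UNIV (\<lambda>_. UNIV))"
      using inner outer by (intro has_sum_SigmaI) auto
    then show ?thesis
      by simp
  qed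
  have f_sums: "(\<lambda>i. \<bar>f x i - f y i\<bar> powr p) sums E x y"
    if xy: "x \<in> mspace X" "y \<in> mspace X" for x y
  proof -
    have "((\<lambda>i. case from_nat_into UNIV i of (n, w) \<Rightarrow> \<bar>\<Phi> n x w - \<Phi> n y w\<bar> powr p)
        has_sum E x y) UNIV"
      using pair_sum [OF xy] has_sum_reindex_bij_betw [OF bij] by blast
    moreover have "(case from_nat_into UNIV i of (n, w) \<Rightarrow> \<bar>\<Phi> n x w - \<Phi> n y w\<bar> powr p) =
        \<bar>f x i - f y i\<bar> powr p" for i
      by (simp add: f_def split: prod.split)
    ultimately show ?thesis
      by (simp add: has_sum_imp_sums)
  qed
  have f_in: "f x \<in> lp_space p" if "x \<in> mspace X" for x
  proof -
    have "f x0 = (\<lambda>i. 0)"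
      by (auto simp: f_def fun_eq_iff split: prod.split)
    then show ?thesis
      using f_sums [OF that x0 [OF that]] by (simp add: lp_space_def sums_iff)
  qed
  have dist: "mdist (lp_metric p) (f x) (f y) = E x y powr (1 / p)"
    if "x \<in> mspace X" "y \<in> mspace X" for x y
    using f_sums [OF that] p by (simp add: mdist_lp_metric lp_norm_def sums_iff)
  have "coarse_embedding X (lp_metric p) f"
  proof (rule coarse_embeddingI)
    show "f \<in> mspace X \<rightarrow> mspace (lp_metric p)"
      using f_in p by (simp add: mspace_lp_metric)
  next
    fix r :: real
    obtain N where N: "r \<le> real N"
      using real_arch_simple by blast
    have "mdist (lp_metric p) (f x) (f y) \<le> (real N * K + 2) powr (1 / p)"
      if xy: "x \<in> mspace X" "y \<in> mspace X" "mdist X x y \<le> r" for x y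
    proof -
      have "E x y \<le> real N * K + 2"
        using D_le [OF xy(1,2), of N] xy(3) N D_summable [OF xy(1,2)]
        unfolding E_def by (intro has_sum_mono [OF has_sum_infsum M_sum]) auto
      moreover have "0 \<le> E x y"
        unfolding E_def by (rule infsum_nonneg) (rule D_nonneg)
      ultimately show ?thesis
        using dist [OF xy(1,2)] p by (simp add: powr_mono2)
    qed
    then show "\<exists>S. \<forall>x\<in>mspace X. \<forall>y\<in>mspace X.
        mdist X x y \<le> r \<longrightarrow> mdist (lp_metric p) (f x) (f y) \<le> S"
      by blast
  next
    fix S :: real
    obtain N :: nat where N: "max 0 S powr p / c \<le> real N"
      using real_arch_simple by blast
    obtain R where R: "\<And>n x y. x \<in> mspace X \<Longrightarrow> y \<in> mspace X \<Longrightarrow> R n \<le> mdist X x y \<Longrightarrow>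
        c \<le> D n x y"
      using far by metis
    define r where "r = Max (insert 0 (R ` {..<N}))"
    have r: "R n \<le> r" if "n < N" for n
      unfolding r_def using that by (intro Max_ge) auto
    have "S \<le> mdist (lp_metric p) (f x) (f y)"
      if xy: "x \<in> mspace X" "y \<in> mspace X" "r \<le> mdist X x y" for x y
    proof -
      have "max 0 S powr p \<le> real N * c"
        using N c by (simp add: pos_divide_le_eq)
      also have "\<dots> = (\<Sum>n<N. c)"
        by simp
      also have "\<dots> \<le> (\<Sum>n<N. D n x y)"
        using xy r by (intro sum_mono R) (auto intro: order_trans)
      also have "\<dots> \<le> E x y"
        unfolding E_def using D_summable [OF xy(1,2)] D_nonneg
        by (intro finite_sum_le_infsum) auto
      finally have "(max 0 S powr p) powr (1 / p) \<le> E x y powr (1 / p)"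
        using p by (intro powr_mono2) auto
      then show ?thesis
        using p dist [OF xy(1,2)] by (simp add: powr_powr)
    qed
    then show "\<exists>r. \<forall>x\<in>mspace X. \<forall>y\<in>mspace X.
        r \<le> mdist X x y \<longrightarrow> S \<le> mdist (lp_metric p) (f x) (f y)"
      by blast
  qed
  then show ?thesis
    unfolding coarsely_embeds_def by blast
qed

section \<open>The Gaussian feature map\<close>

text \<open>Fubini for a doubly indexed real series, in the form in which absolute convergence is
  established row by row.\<close>

lemma has_sum_Sigma_abs:
  fixes f :: "'a \<times> 'b \<Rightarrow> real"
  assumes f: "\<And>x. x \<in> A \<Longrightarrow> ((\<lambda>y. f (x, y)) has_sum g x) (B x)"
    and abs: "\<And>x. x \<in> A \<Longrightarrow> ((\<lambda>y. \<bar>f (x, y)\<bar>) has_sum h x) (B x)"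
    and h: "h summable_on A" and g: "(g has_sum S) A"
  shows "(f has_sum S) (Sigma A B)"
proof -
  have "(\<lambda>z. \<bar>f z\<bar>) summable_on Sigma A B"
    using abs h by (intro summable_on_SigmaI) auto
  then have "f summable_on Sigma A B"
    using summable_on_iff_abs_summable_on_real [of f "Sigma A B"] by simp
  then show ?thesis
    using f g by (intro has_sum_SigmaI)
qed

lemma has_sum_diff:
  fixes f g :: "'a \<Rightarrow> real"
  assumes "(f has_sum a) A" "(g has_sum b) A"
  shows "((\<lambda>x. f x - g x) has_sum (a - b)) A"
  using has_sum_add [OF assms(1) has_sum_uminusI [OF assms(2)]] by simp

text \<open>
  Expanding the \<open>n\<close>-th power of a series gives one product for each word of length \<open>n\<close>. The two
  claims go through the induction together because splitting off the first letter requires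
  absolute convergence for the remaining word.
\<close>

lemma has_sum_words_of_length:
  fixes z :: "'a \<Rightarrow> real"
  assumes z: "(z has_sum S) UNIV" and abs: "((\<lambda>a. \<bar>z a\<bar>) has_sum A) UNIV"
  shows "((\<lambda>w. prod_list (map z w)) has_sum S ^ n) {w. length w = n} \<and>
    ((\<lambda>w. \<bar>prod_list (map z w)\<bar>) has_sum A ^ n) {w. length w = n}"
proof (induction n)
  case 0
  have "{w :: 'a list. length w = 0} = {[]}"
    by auto
  then show ?case
    by (auto intro!: has_sum_finiteI)
next
  case (Suc n)
  let ?W = "{w :: 'a list. length w = n}"
  let ?c = "\<lambda>(a, w). a # w"
  have bij: "bij_betw ?c (Sigma UNIV (\<lambda>_. ?W)) {w. length w = Suc n}"
    by (rule bij_betwI [where g = "\<lambda>w. (hd w, tl w)"]) (auto simp: length_Suc_conv)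
  have row: "((\<lambda>w. prod_list (map z (?c (a, w)))) has_sum z a * S ^ n) ?W"
    "((\<lambda>w. \<bar>prod_list (map z (?c (a, w)))\<bar>) has_sum \<bar>z a\<bar> * A ^ n) ?W" for a
    using Suc by (auto simp: abs_mult intro: has_sum_cmult_right)
  have col: "((\<lambda>a. z a * S ^ n) has_sum S ^ Suc n) UNIV"
    "((\<lambda>a. \<bar>z a\<bar> * A ^ n) has_sum A ^ Suc n) UNIV"
    using has_sum_cmult_left [OF z, of "S ^ n"] has_sum_cmult_left [OF abs, of "A ^ n"] by auto
  have "((\<lambda>v. prod_list (map z (?c v))) has_sum S ^ Suc n) (Sigma UNIV (\<lambda>_. ?W))"
    using row col(1) has_sum_imp_summable [OF col(2)] by (intro has_sum_Sigma_abs)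
  moreover have "((\<lambda>v. \<bar>prod_list (map z (?c v))\<bar>) has_sum A ^ Suc n) (Sigma UNIV (\<lambda>_. ?W))"
    by (rule has_sum_Sigma_abs [OF row(2) _ has_sum_imp_summable [OF col(2)] col(2)])
      (use row(2) in simp)
  ultimately show ?case
    using has_sum_reindex_bij_betw [OF bij] by blast
qed

lemma has_sum_words_exp:
  fixes z :: "'a \<Rightarrow> real"
  assumes z: "(z has_sum S) UNIV"
  shows "((\<lambda>w. prod_list (map z w) / fact (length w)) has_sum exp S) UNIV"
proof -
  have "(\<lambda>a. \<bar>z a\<bar>) summable_on UNIV"
    using summable_on_iff_abs_summable_on_real [of z UNIV] has_sum_imp_summable [OF z] by simp
  then obtain A where A: "((\<lambda>a. \<bar>z a\<bar>) has_sum A) UNIV"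
    unfolding summable_on_def by blast
  let ?W = "\<lambda>n. {w :: 'a list. length w = n}"
  let ?g = "\<lambda>w. prod_list (map z w) / fact (length w)"
  have series: "((\<lambda>n. s ^ n / fact n) has_sum exp s) UNIV" for s :: real
    using exp_converges [of s] summable_norm_exp [of s]
    by (intro norm_summable_imp_has_sum) (simp_all add: divide_inverse mult.commute)
  have "((\<lambda>w. ?g (snd (n, w))) has_sum S ^ n / fact n) (?W n)"
    "((\<lambda>w. \<bar>?g (snd (n, w))\<bar>) has_sum A ^ n / fact n) (?W n)" for n
  proof -
    have "((\<lambda>w. prod_list (map z w) / fact n) has_sum S ^ n / fact n) (?W n)"
      "((\<lambda>w. \<bar>prod_list (map z w)\<bar> / fact n) has_sum A ^ n / fact n) (?W n)"
      using has_sum_words_of_length [OF z A, of n] by (auto intro: has_sum_divide_const)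
    moreover have "((\<lambda>w. h (prod_list (map z w)) / fact n) has_sum t) (?W n) \<longleftrightarrow>
        ((\<lambda>w. h (prod_list (map z w)) / fact (length w)) has_sum t) (?W n)"
      for h :: "real \<Rightarrow> real" and t
      by (rule has_sum_cong) simp
    note this [of "\<lambda>x. x"] this [of abs]
    ultimately show "((\<lambda>w. ?g (snd (n, w))) has_sum S ^ n / fact n) (?W n)"
      "((\<lambda>w. \<bar>?g (snd (n, w))\<bar>) has_sum A ^ n / fact n) (?W n)"
      by simp_all
  qed
  then have "((\<lambda>v. ?g (snd v)) has_sum exp S) (Sigma UNIV ?W)"
    using series [of S] has_sum_imp_summable [OF series [of A]]
    by (intro has_sum_Sigma_abs)
  moreover have "bij_betw snd (Sigma UNIV ?W) UNIV"
    by (rule bij_betwI [where g = "\<lambda>w. (length w, w)"]) auto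
  ultimately show ?thesis
    using has_sum_reindex_bij_betw by blast
qed

text \<open>
  The tensor powers \<open>u \<otimes> \<dots> \<otimes> u / sqrt (n!)\<close> written out in coordinates, with one coordinate for each word,
  and normalised to length one.
\<close>

definition gauss_feature :: "(nat \<Rightarrow> real) \<Rightarrow> nat list \<Rightarrow> real"
  where "gauss_feature u w =
    exp (- ((lp_norm 2 u)\<^sup>2 / 2)) * prod_list (map u w) / sqrt (fact (length w))"

lemma has_sum_l2_norm:
  assumes "u \<in> lp_space 2"
  shows "((\<lambda>i. (u i)\<^sup>2) has_sum (lp_norm 2 u)\<^sup>2) UNIV"
proof -
  have "(lp_norm 2 u)\<^sup>2 = (\<Sum>i. (u i)\<^sup>2)"
    using lp_norm_powr [of 2 u] assms by simp
  moreover have "summable (\<lambda>i. (u i)\<^sup>2)"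
    using assms by (simp add: lp_space_def)
  ultimately show ?thesis
    by (intro sums_nonneg_imp_has_sum) (simp_all add: summable_sums)
qed

text \<open>Polarisation expresses the inner product by norms, which also shows that it converges.\<close>

lemma has_sum_l2_inner:
  assumes u: "u \<in> lp_space 2" and v: "v \<in> lp_space 2"
  shows "((\<lambda>i. u i * v i) has_sum
    ((lp_norm 2 u)\<^sup>2 + (lp_norm 2 v)\<^sup>2 - (lp_norm 2 (\<lambda>i. u i - v i))\<^sup>2) / 2) UNIV"
proof -
  have "((\<lambda>i. ((u i)\<^sup>2 + (v i)\<^sup>2 - (u i - v i)\<^sup>2) / 2) has_sum
      ((lp_norm 2 u)\<^sup>2 + (lp_norm 2 v)\<^sup>2 - (lp_norm 2 (\<lambda>i. u i - v i))\<^sup>2) / 2) UNIV"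
    using u v lp_space_diff [OF _ u v]
    by (intro has_sum_divide_const has_sum_diff has_sum_add has_sum_l2_norm) auto
  moreover have "((u i)\<^sup>2 + (v i)\<^sup>2 - (u i - v i)\<^sup>2) / 2 = u i * v i" for i
    by (simp add: power2_diff)
  ultimately show ?thesis
    by simp
qed

text \<open>
  Multiplying coordinates, the square roots combine to the factor \<open>1 / n!\<close> of the exponential
  series of the inner product \<open>\<langle>u, v\<rangle>\<close>, and the two normalising factors complete
  \<open>exp \<langle>u, v\<rangle>\<close> to the Gaussian.
\<close>

lemma gauss_feature_kernel:
  assumes u: "u \<in> lp_space 2" and v: "v \<in> lp_space 2"
  shows "((\<lambda>w. gauss_feature u w * gauss_feature v w) has_sum
    exp (- ((lp_norm 2 (\<lambda>i. u i - v i))\<^sup>2 / 2))) UNIV"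
proof -
  define a where "a = exp (- ((lp_norm 2 u)\<^sup>2 / 2)) * exp (- ((lp_norm 2 v)\<^sup>2 / 2))"
  have prod: "prod_list (map (\<lambda>i. u i * v i) w) = prod_list (map u w) * prod_list (map v w)" for w
    by (induction w) auto
  have "gauss_feature u w * gauss_feature v w =
      a * (prod_list (map (\<lambda>i. u i * v i) w) / fact (length w))" for w
    by (simp add: gauss_feature_def a_def prod field_simps flip: power2_eq_square)
  moreover have "a * exp (((lp_norm 2 u)\<^sup>2 + (lp_norm 2 v)\<^sup>2 -
      (lp_norm 2 (\<lambda>i. u i - v i))\<^sup>2) / 2) = exp (- ((lp_norm 2 (\<lambda>i. u i - v i))\<^sup>2 / 2))"
    by (simp add: a_def field_simps flip: exp_add)
  ultimately show ?thesis
    using has_sum_cmult_right [OF has_sum_words_exp [OF has_sum_l2_inner [OF u v]], of a] by simp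
qed

lemma gauss_feature_norm:
  assumes "u \<in> lp_space 2"
  shows "((\<lambda>w. (gauss_feature u w)\<^sup>2) has_sum 1) UNIV"
  using gauss_feature_kernel [OF assms assms] by (simp add: power2_eq_square lp_norm_def)

lemma gauss_feature_dist:
  assumes u: "u \<in> lp_space 2" and v: "v \<in> lp_space 2"
  shows "((\<lambda>w. (gauss_feature u w - gauss_feature v w)\<^sup>2) has_sum
    2 - 2 * exp (- ((lp_norm 2 (\<lambda>i. u i - v i))\<^sup>2 / 2))) UNIV"
proof -
  have "((\<lambda>w. (gauss_feature u w)\<^sup>2 + (gauss_feature v w)\<^sup>2 -
      2 * (gauss_feature u w * gauss_feature v w)) has_sum
      1 + 1 - 2 * exp (- ((lp_norm 2 (\<lambda>i. u i - v i))\<^sup>2 / 2))) UNIV"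
    by (intro has_sum_diff has_sum_add has_sum_cmult_right gauss_feature_norm
        gauss_feature_kernel u v)
  then show ?thesis
    by (simp add: power2_diff mult.assoc)
qed

section \<open>The Mazur map\<close>

definition signed_powr :: "real \<Rightarrow> real \<Rightarrow> real"
  where "signed_powr r a = sgn a * \<bar>a\<bar> powr r"

lemma abs_signed_powr [simp]: "\<bar>signed_powr r a\<bar> = \<bar>a\<bar> powr r"
  by (auto simp: signed_powr_def abs_mult sgn_if)

lemma signed_powr_mult: "signed_powr r (a * b) = signed_powr r a * signed_powr r b"
  by (simp add: signed_powr_def sgn_mult abs_mult powr_mult)

lemma signed_powr_inverse:
  assumes "r \<noteq> 0"
  shows "signed_powr (1 / r) (signed_powr r a) = a"
proof (cases "a = 0")
  case True
  then show ?thesis by (simp add: signed_powr_def)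
next
  case False
  then have "sgn (signed_powr r a) = sgn a"
    by (simp add: signed_powr_def sgn_mult)
  then show ?thesis
    using assms False unfolding signed_powr_def [of "1 / r"]
    by (simp add: powr_powr sgn_mult_abs)
qed

text \<open>
  Both sides are homogeneous of degree \<open>q\<close> in \<open>(a, b)\<close>, since the signed power is
  multiplicative. So one may take the entry of larger modulus to be \<open>1\<close> and the other, \<open>c\<close>,
  in \<open>[-1, 1]\<close>. If \<open>c\<close> is close to \<open>1\<close>, the term \<open>\<delta>\<close> suffices; otherwise the signed power of
  \<open>c\<close> has distance at least some \<open>\<kappa> > 0\<close> from \<open>1\<close>, while the left-hand side is at most
  \<open>2 powr q\<close>.

  Summed over the coordinates of two unit vectors of \<open>\<ell>\<^sub>q\<close>, the inequality says that the map from
  the sphere of \<open>\<ell>\<^sub>s\<close> with \<open>s = q / r\<close> back to that of \<open>\<ell>\<^sub>q\<close> is uniformly continuous: the error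
  term contributes only \<open>2 * \<delta>\<close>.
\<close>

lemma signed_powr_modulus:
  fixes q r \<delta> :: real
  assumes q: "q > 0" and r: "r > 0" and \<delta>: "\<delta> > 0"
  shows "\<exists>C>0. \<forall>a b. \<bar>a - b\<bar> powr q \<le>
    C * \<bar>signed_powr r a - signed_powr r b\<bar> powr (q / r) + \<delta> * (\<bar>a\<bar> powr q + \<bar>b\<bar> powr q)"
proof -
  define \<eta> where "\<eta> = min (1 / 2) (\<delta> powr (1 / q))"
  have \<eta>: "0 < \<eta>" "\<eta> < 1"
    using \<delta> by (auto simp: \<eta>_def)
  have "\<eta> powr q \<le> (\<delta> powr (1 / q)) powr q"
    using q \<eta> by (intro powr_mono2) (auto simp: \<eta>_def)
  then have \<eta>_powr: "\<eta> powr q \<le> \<delta>"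
    using q \<delta> by (simp add: powr_powr)
  define \<kappa> where "\<kappa> = 1 - (1 - \<eta>) powr r"
  have "(1 - \<eta>) powr r < 1 powr r"
    using \<eta> r by (intro powr_less_mono2) auto
  then have \<kappa>: "\<kappa> > 0"
    by (simp add: \<kappa>_def)
  define C where "C = 2 powr q / \<kappa> powr (q / r)"
  have C: "C > 0"
    using \<kappa> by (simp add: C_def)
  have unit: "\<bar>1 - c\<bar> powr q \<le> C * \<bar>1 - signed_powr r c\<bar> powr (q / r) + \<delta>" if c: "\<bar>c\<bar> \<le> 1" for c
  proof (cases "1 - \<eta> \<le> c")
    case True
    then have "\<bar>1 - c\<bar> powr q \<le> \<eta> powr q"
      using c q by (intro powr_mono2) auto
    moreover have "0 \<le> C * \<bar>1 - signed_powr r c\<bar> powr (q / r)"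
      using C by simp
    ultimately show ?thesis
      using \<eta>_powr by linarith
  next
    case False
    have "signed_powr r c \<le> (1 - \<eta>) powr r"
    proof (cases "c > 0")
      case True
      then show ?thesis
        using False r by (simp add: signed_powr_def powr_mono2)
    next
      case False
      then have "signed_powr r c \<le> 0"
        by (simp add: signed_powr_def sgn_if)
      then show ?thesis
        using powr_ge_zero [of "1 - \<eta>" r] by linarith
    qed
    then have "\<kappa> powr (q / r) \<le> \<bar>1 - signed_powr r c\<bar> powr (q / r)"
      using \<kappa> q r by (intro powr_mono2) (auto simp: \<kappa>_def)
    then have "C * \<kappa> powr (q / r) \<le> C * \<bar>1 - signed_powr r c\<bar> powr (q / r)"
      using C by (intro mult_left_mono) auto
    moreover have "\<bar>1 - c\<bar> powr q \<le> 2 powr q"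
      using c q by (intro powr_mono2) auto
    moreover have "C * \<kappa> powr (q / r) = 2 powr q"
      using \<kappa> by (simp add: C_def)
    ultimately show ?thesis
      using \<delta> by linarith
  qed
  have ordered: "\<bar>a - b\<bar> powr q \<le>
      C * \<bar>signed_powr r a - signed_powr r b\<bar> powr (q / r) + \<delta> * \<bar>a\<bar> powr q"
    if ab: "\<bar>b\<bar> \<le> \<bar>a\<bar>" for a b
  proof (cases "a = 0")
    case True
    then show ?thesis
      using ab by simp
  next
    case False
    define c where "c = b / a"
    have b: "b = a * c" and c: "\<bar>c\<bar> \<le> 1"
      using False ab by (auto simp: c_def)
    have "a - b = a * (1 - c)"
      "signed_powr r a - signed_powr r b = signed_powr r a * (1 - signed_powr r c)"
      by (simp_all add: b signed_powr_mult right_diff_distrib)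
    then have eq: "\<bar>a - b\<bar> powr q = \<bar>a\<bar> powr q * \<bar>1 - c\<bar> powr q"
      "\<bar>signed_powr r a - signed_powr r b\<bar> powr (q / r) =
        \<bar>a\<bar> powr q * \<bar>1 - signed_powr r c\<bar> powr (q / r)"
      using r by (simp_all add: abs_mult powr_mult powr_powr)
    have "\<bar>a\<bar> powr q * \<bar>1 - c\<bar> powr q \<le>
        \<bar>a\<bar> powr q * (C * \<bar>1 - signed_powr r c\<bar> powr (q / r) + \<delta>)"
      using unit [OF c] by (intro mult_left_mono) auto
    then show ?thesis
      unfolding eq by (simp add: algebra_simps)
  qed
  have "\<bar>a - b\<bar> powr q \<le>
      C * \<bar>signed_powr r a - signed_powr r b\<bar> powr (q / r) + \<delta> * (\<bar>a\<bar> powr q + \<bar>b\<bar> powr q)" for a b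
  proof -
    have nonneg: "0 \<le> \<delta> * \<bar>a\<bar> powr q" "0 \<le> \<delta> * \<bar>b\<bar> powr q"
      using \<delta> by auto
    show ?thesis
    proof (cases "\<bar>b\<bar> \<le> \<bar>a\<bar>")
      case True
      then show ?thesis
        using ordered [of b a] nonneg by (simp add: distrib_left)
    next
      case False
      then show ?thesis
        using ordered [of a b] nonneg
        by (simp add: distrib_left abs_minus_commute [of a b]
            abs_minus_commute [of "signed_powr r a"])
    qed
  qed
  then show ?thesis
    using C by blast
qed

definition sphere_map :: "real \<Rightarrow> (nat \<Rightarrow> real) \<Rightarrow> nat list \<Rightarrow> real"
  where "sphere_map p u w = signed_powr (2 / p) (gauss_feature u w)"

definition sphere_dist :: "real \<Rightarrow> (nat \<Rightarrow> real) \<Rightarrow> (nat \<Rightarrow> real) \<Rightarrow> real"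
  where "sphere_dist p u v = (\<Sum>\<^sub>\<infinity>w. \<bar>sphere_map p u w - sphere_map p v w\<bar> powr p)"

lemma abs_sphere_map_powr:
  "p > 0 \<Longrightarrow> \<bar>sphere_map p u w\<bar> powr p = (gauss_feature u w)\<^sup>2"
  by (simp add: sphere_map_def powr_powr)

lemma signed_powr_sphere_map:
  "p > 0 \<Longrightarrow> signed_powr (p / 2) (sphere_map p u w) = gauss_feature u w"
  using signed_powr_inverse [of "2 / p"] by (simp add: sphere_map_def)

text \<open>The right-hand side of the inequality for signed powers, summed over all words.\<close>

lemma has_sum_sphere_error:
  assumes u: "u \<in> lp_space 2" and v: "v \<in> lp_space 2" and d: "(g has_sum d) UNIV"
  shows "((\<lambda>w. C * g w + \<delta> * ((gauss_feature u w)\<^sup>2 + (gauss_feature v w)\<^sup>2)) has_sum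
    (C * d + 2 * \<delta>)) UNIV"
proof -
  have "((\<lambda>w. C * g w + \<delta> * ((gauss_feature u w)\<^sup>2 + (gauss_feature v w)\<^sup>2)) has_sum
    (C * d + \<delta> * (1 + 1))) UNIV"
    by (intro has_sum_add has_sum_cmult_right d gauss_feature_norm u v)
  then show ?thesis
    by (simp add: mult.commute)
qed

text \<open>Uniform continuity of the Mazur map from \<open>\<ell>\<^sub>2\<close> to \<open>\<ell>\<^sub>p\<close>: the inequality for signed powers
  is applied to the inverse exponent \<open>p / 2\<close>, which recovers the Gaussian coordinates.\<close>

lemma sphere_dist_le:
  assumes p: "p > 0" and \<delta>: "\<delta> > 0"
  shows "\<exists>C>0. \<forall>u\<in>lp_space 2. \<forall>v\<in>lp_space 2.
    (\<lambda>w. \<bar>sphere_map p u w - sphere_map p v w\<bar> powr p) summable_on UNIV \<and>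
    sphere_dist p u v \<le> C * (2 - 2 * exp (- ((lp_norm 2 (\<lambda>i. u i - v i))\<^sup>2 / 2))) + 2 * \<delta>"
proof -
  obtain C where "C > 0" and C: "\<And>a b. \<bar>a - b\<bar> powr p \<le>
      C * \<bar>signed_powr (p / 2) a - signed_powr (p / 2) b\<bar> powr (p / (p / 2)) +
      \<delta> * (\<bar>a\<bar> powr p + \<bar>b\<bar> powr p)"
    using signed_powr_modulus [of p "p / 2" \<delta>] p \<delta> by auto
  have le: "\<bar>sphere_map p u w - sphere_map p v w\<bar> powr p \<le>
      C * (gauss_feature u w - gauss_feature v w)\<^sup>2 +
      \<delta> * ((gauss_feature u w)\<^sup>2 + (gauss_feature v w)\<^sup>2)" for u v w
    using C [of "sphere_map p u w" "sphere_map p v w"] p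
    by (simp add: signed_powr_sphere_map abs_sphere_map_powr)
  {
    fix u v assume uv: "u \<in> lp_space 2" "v \<in> lp_space 2"
    note sum = has_sum_sphere_error [OF uv gauss_feature_dist [OF uv], of C \<delta>]
    have summable: "(\<lambda>w. \<bar>sphere_map p u w - sphere_map p v w\<bar> powr p) summable_on UNIV"
      by (rule summable_on_comparison_test [OF has_sum_imp_summable [OF sum]]) (auto intro: le)
    moreover have "sphere_dist p u v \<le>
        C * (2 - 2 * exp (- ((lp_norm 2 (\<lambda>i. u i - v i))\<^sup>2 / 2))) + 2 * \<delta>"
      unfolding sphere_dist_def using has_sum_mono [OF has_sum_infsum [OF summable] sum le] .
    ultimately have "(\<lambda>w. \<bar>sphere_map p u w - sphere_map p v w\<bar> powr p) summable_on UNIV \<and>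
      sphere_dist p u v \<le> C * (2 - 2 * exp (- ((lp_norm 2 (\<lambda>i. u i - v i))\<^sup>2 / 2))) + 2 * \<delta>"
      by blast
  }
  then show ?thesis
    using \<open>C > 0\<close> by blast
qed

text \<open>Uniform continuity of the inverse map, from \<open>\<ell>\<^sub>p\<close> to \<open>\<ell>\<^sub>2\<close>.\<close>

lemma sphere_dist_ge:
  assumes p: "p > 0" and \<delta>: "\<delta> > 0"
  shows "\<exists>C>0. \<forall>u\<in>lp_space 2. \<forall>v\<in>lp_space 2.
    2 - 2 * exp (- ((lp_norm 2 (\<lambda>i. u i - v i))\<^sup>2 / 2)) \<le> C * sphere_dist p u v + 2 * \<delta>"
proof -
  obtain C where "C > 0" and C: "\<And>a b. \<bar>a - b\<bar> powr 2 \<le>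
      C * \<bar>signed_powr (2 / p) a - signed_powr (2 / p) b\<bar> powr (2 / (2 / p)) +
      \<delta> * (\<bar>a\<bar> powr 2 + \<bar>b\<bar> powr 2)"
    using signed_powr_modulus [of 2 "2 / p" \<delta>] p \<delta> by auto
  have le: "(gauss_feature u w - gauss_feature v w)\<^sup>2 \<le>
      C * \<bar>sphere_map p u w - sphere_map p v w\<bar> powr p +
      \<delta> * ((gauss_feature u w)\<^sup>2 + (gauss_feature v w)\<^sup>2)" for u v w
    using C [of "gauss_feature u w" "gauss_feature v w"] by (simp add: sphere_map_def)
  {
    fix u v assume uv: "u \<in> lp_space 2" "v \<in> lp_space 2"
    have "((\<lambda>w. \<bar>sphere_map p u w - sphere_map p v w\<bar> powr p) has_sum sphere_dist p u v) UNIV"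
      unfolding sphere_dist_def using sphere_dist_le [OF p \<delta>] uv by (intro has_sum_infsum) blast
    note sum = has_sum_sphere_error [OF uv this, of C \<delta>]
    have "2 - 2 * exp (- ((lp_norm 2 (\<lambda>i. u i - v i))\<^sup>2 / 2)) \<le> C * sphere_dist p u v + 2 * \<delta>"
      using has_sum_mono [OF gauss_feature_dist [OF uv] sum le] .
  }
  then show ?thesis
    using \<open>C > 0\<close> by blast
qed

section \<open>Embedding Hilbert space\<close>

lemma lp_space_scale:
  assumes "x \<in> lp_space p"
  shows "(\<lambda>i. s * x i) \<in> lp_space p"
  using assms by (simp add: lp_space_def abs_mult powr_mult summable_mult)

lemma l2_norm_scale_diff:
  assumes "x \<in> lp_space 2" "y \<in> lp_space 2"
  shows "(lp_norm 2 (\<lambda>i. s * x i - s * y i))\<^sup>2 = s\<^sup>2 * (lp_norm 2 (\<lambda>i. x i - y i))\<^sup>2"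
proof -
  let ?d = "\<lambda>i. x i - y i"
  have d: "?d \<in> lp_space 2"
    using lp_space_diff [of 2 x y] assms by simp
  have "((\<lambda>i. (s * ?d i)\<^sup>2) has_sum (s\<^sup>2 * (lp_norm 2 ?d)\<^sup>2)) UNIV"
    unfolding power_mult_distrib by (intro has_sum_cmult_right has_sum_l2_norm d)
  then have "(lp_norm 2 (\<lambda>i. s * ?d i))\<^sup>2 = s\<^sup>2 * (lp_norm 2 ?d)\<^sup>2"
    using has_sum_l2_norm [OF lp_space_scale [OF d]] has_sum_unique by blast
  then show ?thesis
    by (simp add: right_diff_distrib)
qed

text \<open>
  After a dilation by \<open>s\<close>, the squared distance of the Gaussian images is at most \<open>s\<^sup>2 * R\<^sup>2\<close>,
  because \<open>1 - exp (- t) \<le> t\<close>. One half of \<open>\<epsilon>\<close> pays for the multiple \<open>C\<close> of this and the other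
  for the error term.
\<close>

lemma sphere_dist_small_at_scale:
  assumes p: "p > 0" and \<epsilon>: "\<epsilon> > 0"
  shows "\<exists>s>0. \<forall>x\<in>lp_space 2. \<forall>y\<in>lp_space 2. lp_norm 2 (\<lambda>i. x i - y i) \<le> R \<longrightarrow>
    sphere_dist p (\<lambda>i. s * x i) (\<lambda>i. s * y i) \<le> \<epsilon>"
proof -
  obtain C where C: "C > 0" and le: "\<And>u v. u \<in> lp_space 2 \<Longrightarrow> v \<in> lp_space 2 \<Longrightarrow>
      sphere_dist p u v \<le>
        C * (2 - 2 * exp (- ((lp_norm 2 (\<lambda>i. u i - v i))\<^sup>2 / 2))) + 2 * (\<epsilon> / 4)"
    using sphere_dist_le [OF p, of "\<epsilon> / 4"] \<epsilon> by auto
  \<comment> \<open>Adding \<open>1\<close> to \<open>R\<^sup>2\<close> avoids division by zero for \<open>R = 0\<close>.\<close>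
  define s where "s = sqrt (\<epsilon> / (2 * C * (R\<^sup>2 + 1)))"
  have R: "0 < R\<^sup>2 + 1"
    by (simp add: add_nonneg_pos)
  have s: "s > 0" and s2: "s\<^sup>2 = \<epsilon> / (2 * C * (R\<^sup>2 + 1))"
    using \<epsilon> C R by (simp_all add: s_def)
  have "sphere_dist p (\<lambda>i. s * x i) (\<lambda>i. s * y i) \<le> \<epsilon>"
    if xy: "x \<in> lp_space 2" "y \<in> lp_space 2" and d: "lp_norm 2 (\<lambda>i. x i - y i) \<le> R" for x y
  proof -
    define t where "t = s\<^sup>2 * (lp_norm 2 (\<lambda>i. x i - y i))\<^sup>2"
    have "1 - t / 2 \<le> exp (- (t / 2))"
      using exp_ge_add_one_self [of "- (t / 2)"] by simp
    then have "C * (2 - 2 * exp (- (t / 2))) \<le> C * t"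
      using C by (intro mult_left_mono) auto
    also have "\<dots> \<le> C * (s\<^sup>2 * (R\<^sup>2 + 1))"
    proof -
      have "(lp_norm 2 (\<lambda>i. x i - y i))\<^sup>2 \<le> R\<^sup>2"
        using d by (intro power_mono) auto
      then show ?thesis
        unfolding t_def using C by (intro mult_left_mono) auto
    qed
    also have "\<dots> = \<epsilon> / 2"
    proof -
      have "C * (\<epsilon> / (2 * C * T) * T) = \<epsilon> / 2" if "T > 0" for T
        using C that by simp
      then show ?thesis
        unfolding s2 using R by blast
    qed
    finally show ?thesis
      using le [OF lp_space_scale [OF xy(1), of s] lp_space_scale [OF xy(2), of s]]
      by (simp add: l2_norm_scale_diff [OF xy] t_def)
  qed
  then show ?thesis
    using s by blast
qed

lemma sphere_dist_bounded:
  assumes "p > 0"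
  shows "\<exists>K. \<forall>u\<in>lp_space 2. \<forall>v\<in>lp_space 2. sphere_dist p u v \<le> K"
proof -
  obtain C where C: "C > 0" and le: "\<And>u v. u \<in> lp_space 2 \<Longrightarrow> v \<in> lp_space 2 \<Longrightarrow>
      sphere_dist p u v \<le> C * (2 - 2 * exp (- ((lp_norm 2 (\<lambda>i. u i - v i))\<^sup>2 / 2))) + 2 * 1"
    using sphere_dist_le [OF assms, of 1] by auto
  have "C * (2 - 2 * exp t) \<le> C * 2" for t :: real
    using C by (intro mult_left_mono) auto
  then show ?thesis
    using le by (meson add_right_mono order_trans)
qed

text \<open>
  From squared distance \<open>2 * ln 2\<close> on, the kernel is at most \<open>1 / 2\<close>, so the Gaussian images have
  squared distance at least \<open>1\<close>; an error term of \<open>1 / 2\<close> leaves \<open>1 / 2\<close> for the distance in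
  \<open>\<ell>\<^sub>p\<close>.
\<close>

lemma sphere_dist_separated:
  assumes "p > 0"
  shows "\<exists>c>0. \<forall>u\<in>lp_space 2. \<forall>v\<in>lp_space 2.
    2 * ln 2 \<le> (lp_norm 2 (\<lambda>i. u i - v i))\<^sup>2 \<longrightarrow> c \<le> sphere_dist p u v"
proof -
  obtain C where C: "C > 0" and le: "\<And>u v. u \<in> lp_space 2 \<Longrightarrow> v \<in> lp_space 2 \<Longrightarrow>
      2 - 2 * exp (- ((lp_norm 2 (\<lambda>i. u i - v i))\<^sup>2 / 2)) \<le> C * sphere_dist p u v + 2 * (1 / 4)"
    using sphere_dist_ge [OF assms, of "1 / 4"] by auto
  have "1 / (2 * C) \<le> sphere_dist p u v"
    if uv: "u \<in> lp_space 2" "v \<in> lp_space 2"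
      and far: "2 * ln 2 \<le> (lp_norm 2 (\<lambda>i. u i - v i))\<^sup>2" for u v
  proof -
    have "exp (- ((lp_norm 2 (\<lambda>i. u i - v i))\<^sup>2 / 2)) \<le> exp (- ln 2)"
      using far by simp
    also have "\<dots> = 1 / 2"
      by (simp add: exp_minus)
    finally have "1 / 2 \<le> C * sphere_dist p u v"
      using le [OF uv] by linarith
    then show ?thesis
      using C by (simp add: field_simps)
  qed
  then show ?thesis
    using C by (intro exI [of _ "1 / (2 * C)"]) auto
qed

theorem l2_coarsely_embeds_lp:
  assumes p: "p \<ge> 1"
  shows "coarsely_embeds (lp_metric 2) (lp_metric p)"
proof -
  have p0: "p > 0"
    using p by simp
  have space: "mspace (lp_metric 2) = lp_space 2"
    and dist: "mdist (lp_metric 2) x y = lp_norm 2 (\<lambda>i. x i - y i)" for x y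
    by (simp_all add: mspace_lp_metric mdist_lp_metric)
  obtain s where s: "\<And>n. s n > 0"
    and close: "\<And>n x y. x \<in> lp_space 2 \<Longrightarrow> y \<in> lp_space 2 \<Longrightarrow>
      lp_norm 2 (\<lambda>i. x i - y i) \<le> real n \<Longrightarrow>
      sphere_dist p (\<lambda>i. s n * x i) (\<lambda>i. s n * y i) \<le> (1 / 2) ^ n"
  proof -
    have "\<forall>n. \<exists>s>0. \<forall>x\<in>lp_space 2. \<forall>y\<in>lp_space 2. lp_norm 2 (\<lambda>i. x i - y i) \<le> real n \<longrightarrow>
        sphere_dist p (\<lambda>i. s * x i) (\<lambda>i. s * y i) \<le> (1 / 2) ^ n"
      using sphere_dist_small_at_scale [OF p0] by simp
    then show ?thesis
      using that by metis
  qed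
  obtain K where K: "\<And>u v. u \<in> lp_space 2 \<Longrightarrow> v \<in> lp_space 2 \<Longrightarrow> sphere_dist p u v \<le> K"
    using sphere_dist_bounded [OF p0] by blast
  obtain c where c: "c > 0" and far: "\<And>u v. u \<in> lp_space 2 \<Longrightarrow> v \<in> lp_space 2 \<Longrightarrow>
      2 * ln 2 \<le> (lp_norm 2 (\<lambda>i. u i - v i))\<^sup>2 \<Longrightarrow> c \<le> sphere_dist p u v"
    using sphere_dist_separated [OF p0] by blast
  define \<Phi> where "\<Phi> n x = sphere_map p (\<lambda>i. s n * x i)" for n x
  have D: "(\<Sum>\<^sub>\<infinity>w. \<bar>\<Phi> n x w - \<Phi> n y w\<bar> powr p) =
      sphere_dist p (\<lambda>i. s n * x i) (\<lambda>i. s n * y i)" for n x y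
    by (simp add: \<Phi>_def sphere_dist_def)
  show ?thesis
  proof (rule coarsely_embeds_lp_glue [where X = "lp_metric 2" and p = p and \<Phi> = \<Phi>
        and K = K and c = c, unfolded D space dist])
    show "(\<lambda>w. \<bar>\<Phi> n x w - \<Phi> n y w\<bar> powr p) summable_on UNIV"
      if "x \<in> lp_space 2" "y \<in> lp_space 2" for n x y
      unfolding \<Phi>_def using sphere_dist_le [OF p0 zero_less_one] that lp_space_scale by blast
    show "sphere_dist p (\<lambda>i. s n * x i) (\<lambda>i. s n * y i) \<le> K"
      if "x \<in> lp_space 2" "y \<in> lp_space 2" for n x y
      using that by (intro K lp_space_scale)
    show "\<exists>r. \<forall>x\<in>lp_space 2. \<forall>y\<in>lp_space 2. r \<le> lp_norm 2 (\<lambda>i. x i - y i) \<longrightarrow>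
        c \<le> sphere_dist p (\<lambda>i. s n * x i) (\<lambda>i. s n * y i)" for n
    proof (intro exI ballI impI)
      fix x y assume xy: "x \<in> lp_space 2" "y \<in> lp_space 2"
        and d: "sqrt (2 * ln 2) / s n \<le> lp_norm 2 (\<lambda>i. x i - y i)"
      have "sqrt (2 * ln 2) \<le> s n * lp_norm 2 (\<lambda>i. x i - y i)"
        using d s [of n] by (simp add: pos_divide_le_eq mult.commute)
      then have "2 * ln 2 \<le> (s n * lp_norm 2 (\<lambda>i. x i - y i))\<^sup>2"
        by (rule sqrt_le_D)
      then show "c \<le> sphere_dist p (\<lambda>i. s n * x i) (\<lambda>i. s n * y i)"
        using xy by (intro far lp_space_scale) (simp_all add: l2_norm_scale_diff power_mult_distrib)
    qed
  qed (use p c close in auto)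
qed

theorem corollary4:
  fixes X :: "'a metric"
  shows "(coarsely_embeds X (lp_metric 2) \<longrightarrow> (\<forall>p\<ge>1. coarsely_embeds X (lp_metric p))) \<and>
         (\<forall>p\<ge>1. coarsely_embeds (lp_metric 2) (lp_metric p))"
  using l2_coarsely_embeds_lp coarse_embedding_compose unfolding coarsely_embeds_def by blast

end
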